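(* Let $p\in\mathbf{C}[x_1,\dots,x_n]$ have the following property: whenever $\psi$ is an injective $\mathbf{C}$-algebra endomorphism of $\mathbf{C}[x_1,\dots,x_n]$ with $\psi(p)=p$, $\psi$ is an automorphism of $\mathbf{C}[x_1,\dots,x_n]$. If $q \in \mathbf{C}[x_1,\dots,x_n]$ and $\varphi(p)=q$ for some automorphism $\varphi$ of $\mathbf{C}[x_1,\dots,x_N]$ with $N\ge n$, then $\alpha(p)=q$ for some automorphism $\alpha$ of $\mathbf{C}[x_1,\dots,x_n]$.
   Context: Automorphisms are $\mathbf{C}$-algebra automorphisms; $\mathbf{C}[x_1,\dots,x_n]$ is regarded as a subalgebra of $\mathbf{C}[x_1,\dots,x_N]$. *)

theory Defs
  imports Complex_Main "HOL-Library.Poly_Mapping"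
begin

text \<open>Multivariate polynomials over C: finitely supported maps from monomials
(exponent vectors nat =>0 nat, variable x_(i+1) has index i) to coefficients,
with the convolution product from Poly_Mapping.\<close>
type_synonym mpoly = "(nat \<Rightarrow>\<^sub>0 nat) \<Rightarrow>\<^sub>0 complex"

definition polys :: "nat \<Rightarrow> mpoly set" where
  "polys n = {p :: mpoly. \<forall>m \<in> Poly_Mapping.keys p. Poly_Mapping.keys m \<subseteq> {..<n}}"

definition cpoly :: "complex \<Rightarrow> mpoly" where
  "cpoly c = Poly_Mapping.single 0 c"

definition alg_endo :: "nat \<Rightarrow> (mpoly \<Rightarrow> mpoly) \<Rightarrow> bool" where
  "alg_endo n f \<longleftrightarrow>
     (\<forall>p \<in> polys n. f p \<in> polys n) \<and>
     (\<forall>p \<in> polys n. \<forall>q \<in> polys n. f (p + q) = f p + f q \<and> f (p * q) = f p * f q) \<and>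
     f 1 = 1 \<and>
     (\<forall>c. \<forall>p \<in> polys n. f (cpoly c * p) = cpoly c * f p)"

definition alg_auto :: "nat \<Rightarrow> (mpoly \<Rightarrow> mpoly) \<Rightarrow> bool" where
  "alg_auto n f \<longleftrightarrow> alg_endo n f \<and> bij_betw f (polys n) (polys n)"

end

theory Submission
  imports Defs
begin

text \<open>Write \<open>A\<close> and \<open>B\<close> for the polynomial rings in \<open>n\<close> and \<open>N\<close> variables. There is a retraction
\<open>\<rho>\<close> of \<open>B\<close> onto \<open>A\<close>, sending the variables outside \<open>A\<close> to linear forms, such that
\<open>\<beta> = \<rho> \<circ> \<phi>\<close> is injective on \<open>A\<close>; since \<open>\<rho>\<close> fixes \<open>q\<close>, still \<open>\<beta> p = q\<close>. The same for the
inverse of \<open>\<phi>\<close> gives an injective \<open>\<gamma>\<close> with \<open>\<gamma> q = p\<close>. Then \<open>\<gamma> \<circ> \<beta>\<close> is injective and fixes \<open>p\<close>,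
hence is an automorphism, and so is \<open>\<beta>\<close>.

To find \<open>\<rho>\<close>, translate so that \<open>\<phi>\<close> preserves the origin. The linear parts of the \<open>\<phi> x\<^sub>i\<close>, \<open>i < n\<close>, are
linearly independent because \<open>\<phi>\<close> is invertible, and a suitable linear projection keeps them
independent. After a linear change of variables \<open>\<rho> \<circ> \<phi>\<close> is the identity to first order, hence
preserves initial forms and is injective.\<close>

section \<open>Linear algebra\<close>

text \<open>Gaussian elimination: an unknown \<open>k\<close> occurring in equation \<open>e\<close>
  is eliminated from the other equations, which are solved by induction, and equation
  \<open>e\<close> then fixes the value at \<open>k\<close>.\<close>

lemma underdetermined_system:
  fixes c :: "'j \<Rightarrow> 'i \<Rightarrow> 'a::field"
  assumes "finite I" "finite J" "card I < card J"
  shows "\<exists>b. (\<exists>j\<in>J. b j \<noteq> 0) \<and> (\<forall>i\<in>I. (\<Sum>j\<in>J. b j * c j i) = 0)"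
  using assms
proof (induction I arbitrary: J c rule: finite_induct)
  case empty
  then have "J \<noteq> {}" by auto
  then show ?case by (intro exI[of _ "\<lambda>_. 1"]) auto
next
  case (insert e I)
  show ?case
  proof (cases "\<forall>j\<in>J. c j e = 0")
    case True
    have "card I < card J" using insert by simp
    from insert.IH[OF insert.prems(1) this, of c] True show ?thesis by auto
  next
    case False
    then obtain k where k: "k \<in> J" "c k e \<noteq> 0" by auto
    define c' where "c' j i = c j i - c j e / c k e * c k i" for j i
    have "card I < card (J - {k})" using insert k by simp
    from insert.IH[OF _ this, of c'] insert.prems(1)
    obtain b where b: "\<exists>j\<in>J - {k}. b j \<noteq> 0"
      "\<And>i. i \<in> I \<Longrightarrow> (\<Sum>j\<in>J - {k}. b j * c' j i) = 0" by auto
    define t where "t = (\<Sum>j\<in>J - {k}. b j * c j e)"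
    \<comment> \<open>The remaining unknowns contribute \<open>t\<close> to equation
      \<open>e\<close>; the value at \<open>k\<close> cancels it.\<close>
    define b' where "b' = b(k := - t / c k e)"
    have split: "(\<Sum>j\<in>J. b' j * c j i) = (\<Sum>j\<in>J - {k}. b j * c j i) - t / c k e * c k i" for i
      using k(1) insert.prems(1)
      by (subst sum.remove[of J k]) (auto simp: b'_def intro!: sum.cong)
    have "(\<Sum>j\<in>J. b' j * c j i) = (\<Sum>j\<in>J - {k}. b j * c' j i)" for i
      unfolding split c'_def t_def
      by (simp add: algebra_simps sum_subtractf sum_distrib_left sum_divide_distrib)
    moreover have "(\<Sum>j\<in>J. b' j * c j e) = 0"
      unfolding split using k(2) by (simp add: t_def)
    ultimately show ?thesis
      using b by (intro exI[of _ b']) (auto simp: b'_def)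
  qed
qed

text \<open>Matrices are functions on all of \<open>nat\<close> with explicit bounds, so that the
  number of columns can vary in an induction.\<close>

definition indep_rows :: "nat \<Rightarrow> nat \<Rightarrow> (nat \<Rightarrow> nat \<Rightarrow> 'a::field) \<Rightarrow> bool" where
  "indep_rows n N a \<longleftrightarrow> (\<forall>u. (\<forall>j<N. (\<Sum>i<n. u i * a i j) = 0) \<longrightarrow> (\<forall>i<n. u i = 0))"

text \<open>The \<open>n\<close> rows together with a unit vector are \<open>n + 1\<close> vectors
  in \<open>n\<close>-space, hence dependent. As the rows are independent, each unit vector is a
  combination of them, which gives a left inverse.\<close>

lemma indep_rows_right_inverse:
  fixes a :: "nat \<Rightarrow> nat \<Rightarrow> 'a::field"
  assumes ind: "indep_rows n n a"
  shows "\<exists>b. \<forall>i<n. \<forall>k<n. (\<Sum>j<n. a i j * b j k) = (if i = k then 1 else 0)"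
proof -
  have "\<exists>u. \<forall>k<n. (\<Sum>i<n. u i * a i k) = (if k = j then 1 else 0)" for j
  proof -
    \<comment> \<open>The unit vector of index \<open>j\<close> is appended as row
      \<open>n\<close>.\<close>
    define c where "c i k = (if i < n then a i k else if k = j then 1 else 0)" for i k
    obtain v where v: "\<exists>i\<in>{..<Suc n}. v i \<noteq> 0"
      "\<And>k. k < n \<Longrightarrow> (\<Sum>i<Suc n. v i * c i k) = 0"
      using underdetermined_system[of "{..<n}" "{..<Suc n}" c] by auto
    have eq: "(\<Sum>i<n. v i * a i k) = - v n * (if k = j then 1 else 0)" if "k < n" for k
      using v(2)[OF that] by (simp add: c_def eq_neg_iff_add_eq_0)
    have nz: "v n \<noteq> 0"
    proof
      assume "v n = 0"
      then have "\<forall>k<n. (\<Sum>i<n. v i * a i k) = 0" using eq by simp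
      then have "\<forall>i<n. v i = 0" using ind unfolding indep_rows_def by blast
      with v(1) \<open>v n = 0\<close> show False by (auto simp: less_Suc_eq)
    qed
    have "(\<Sum>i<n. (- v i / v n) * a i k) = (if k = j then 1 else 0)" if "k < n" for k
    proof -
      have "(\<Sum>i<n. (- v i / v n) * a i k) = - (\<Sum>i<n. v i * a i k) / v n"
        by (simp add: sum_divide_distrib sum_negf)
      then show ?thesis using eq[OF that] nz by auto
    qed
    then show ?thesis by (intro exI[of _ "\<lambda>i. - v i / v n"]) auto
  qed
  then obtain b where b: "\<And>j k. k < n \<Longrightarrow> (\<Sum>i<n. b j i * a i k) = (if k = j then 1 else 0)"
    by metis
  \<comment> \<open>\<open>b\<close> is a left inverse, so \<open>(a b - 1) a = 0\<close>, and independence of the rows of \<open>a\<close> cancels \<open>a\<close>.\<close>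
  have "(\<Sum>j<n. a i j * b j k) - (if k = i then 1 else 0) = 0" if i: "i < n" and k: "k < n" for i k
  proof -
    define u where "u k = (\<Sum>j<n. a i j * b j k) - (if k = i then 1 else 0)" for k
    have "(\<Sum>k<n. u k * a k l) = 0" if l: "l < n" for l
    proof -
      have "(\<Sum>k<n. (\<Sum>j<n. a i j * b j k) * a k l) = (\<Sum>j<n. a i j * (\<Sum>k<n. b j k * a k l))"
        unfolding sum_distrib_left sum_distrib_right
        by (subst sum.swap) (simp add: mult.assoc)
      also have "\<dots> = (\<Sum>j<n. if j = l then a i j else 0)"
        by (intro sum.cong refl) (use b[OF l] in auto)
      also have "\<dots> = a i l" using l by simp
      moreover have "(\<Sum>k<n. (if k = i then 1 else 0) * a k l) = (\<Sum>k<n. if k = i then a k l else 0)"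
        by (intro sum.cong) auto
      then have "(\<Sum>k<n. (if k = i then 1 else 0) * a k l) = a i l" using i by simp
      ultimately show ?thesis by (simp add: u_def algebra_simps sum_subtractf)
    qed
    then have "u k = 0" using ind k unfolding indep_rows_def by blast
    then show ?thesis by (simp add: u_def)
  qed
  then show ?thesis by (intro exI[of _ b]) auto
qed

text \<open>Reading rows as linear forms, the form with coefficients \<open>w\<close> is substituted
  for the last variable. One column disappears; \<open>n \<le> N\<close> guarantees that the rows do
  not span the whole space.\<close>

lemma indep_rows_project:
  fixes a :: "nat \<Rightarrow> nat \<Rightarrow> 'a::field"
  assumes ind: "indep_rows n (Suc N) a" and "n \<le> N"
  shows "\<exists>w. indep_rows n N (\<lambda>i j. a i j + a i N * w j)"
proof -
  obtain b where b: "\<exists>j\<in>{..<Suc N}. b j \<noteq> 0" "\<And>i. i < n \<Longrightarrow> (\<Sum>j<Suc N. b j * a i j) = 0"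
    using underdetermined_system[of "{..<n}" "{..<Suc N}" "\<lambda>j i. a i j"] assms by auto
  \<comment> \<open>The rows lie in the hyperplane orthogonal to \<open>b\<close>; projecting along a vector \<open>(- w, 1)\<close> outside this hyperplane is injective on it.\<close>
  obtain w where w: "b N \<noteq> (\<Sum>j<N. w j * b j)"
  proof (cases "b N = 0")
    case True
    then obtain k where k: "k < N" "b k \<noteq> 0" using b(1) by (auto simp: less_Suc_eq)
    have "(\<Sum>j<N. (if j = k then 1 else 0) * b j) = (\<Sum>j<N. if j = k then b j else 0)"
      by (intro sum.cong) auto
    then show ?thesis using k True that[of "\<lambda>j. if j = k then 1 else 0"] by simp
  next
    case False
    then show ?thesis using that[of "\<lambda>_. 0"] by simp
  qed
  have "\<forall>i<n. u i = 0" if u: "\<forall>j<N. (\<Sum>i<n. u i * (a i j + a i N * w j)) = 0" for u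
  proof -
    define t where "t j = (\<Sum>i<n. u i * a i j)" for j
    \<comment> \<open>The projection of the combination \<open>t\<close> vanishes, so
      \<open>t\<close> is \<open>t N\<close> times \<open>(- w, 1)\<close>. Orthogonality to
      \<open>b\<close> and the choice of \<open>w\<close> then force \<open>t N = 0\<close>.\<close>
    have tj: "t j = - t N * w j" if "j < N" for j
    proof -
      have "(\<Sum>i<n. u i * (a i j + a i N * w j)) = t j + t N * w j"
        by (simp add: t_def algebra_simps sum.distrib sum_distrib_left)
      with u that show ?thesis by (simp add: eq_neg_iff_add_eq_0)
    qed
    have "(\<Sum>j<Suc N. t j * b j) = (\<Sum>i<n. u i * (\<Sum>j<Suc N. b j * a i j))"
      unfolding t_def sum_distrib_left sum_distrib_right
      by (subst sum.swap) (simp only: mult_ac)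
    also have "\<dots> = 0" using b(2) by simp
    also have "(\<Sum>j<Suc N. t j * b j) = (\<Sum>j<N. - t N * (w j * b j)) + t N * b N"
      by (simp add: tj mult.assoc)
    also have "(\<Sum>j<N. - t N * (w j * b j)) = - t N * (\<Sum>j<N. w j * b j)"
      by (rule sum_distrib_left[symmetric])
    finally have "t N * (b N - (\<Sum>j<N. w j * b j)) = 0" by (simp add: algebra_simps)
    with w have "t N = 0" by simp
    with tj have "\<forall>j<Suc N. t j = 0" by (auto simp: less_Suc_eq)
    then show ?thesis using ind unfolding indep_rows_def t_def by blast
  qed
  then show ?thesis unfolding indep_rows_def by blast
qed

text \<open>The extra columns are removed one at a time, from the last one down to column
  \<open>n\<close>. The matrix \<open>R\<close> of the composite projection is the identity on the
  first \<open>n\<close> coordinates.\<close>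

lemma indep_rows_retract:
  fixes a :: "nat \<Rightarrow> nat \<Rightarrow> 'a::field"
  assumes "n \<le> N" "indep_rows n N a"
  shows "\<exists>R. (\<forall>j<n. \<forall>k. R j k = (if j = k then 1 else 0)) \<and> indep_rows n n (\<lambda>i k. \<Sum>j<N. a i j * R j k)"
  using assms
proof (induction N arbitrary: a rule: dec_induct)
  case base
  have "(\<Sum>j<n. a i j * (if j = k then 1 else 0)) = a i k" if "k < n" for i k
  proof -
    have "(\<Sum>j<n. a i j * (if j = k then 1 else 0)) = (\<Sum>j<n. if j = k then a i j else 0)"
      by (intro sum.cong) auto
    then show ?thesis using that by simp
  qed
  then show ?case
    using base by (intro exI[of _ "\<lambda>j k. if j = k then 1 else 0"]) (auto simp: indep_rows_def)
next
  case (step N)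
  obtain w where "indep_rows n N (\<lambda>i j. a i j + a i N * w j)"
    using indep_rows_project[OF step.prems step.hyps(1)] by blast
  from step.IH[OF this] obtain R where
    R: "\<And>j k. j < n \<Longrightarrow> R j k = (if j = k then 1 else 0)"
       "indep_rows n n (\<lambda>i k. \<Sum>j<N. (a i j + a i N * w j) * R j k)" by blast
  \<comment> \<open>The last variable goes to the form \<open>w\<close>, to which the projection
    already found is applied.\<close>
  define R' where "R' = R(N := \<lambda>k. \<Sum>j<N. w j * R j k)"
  have "(\<Sum>j<Suc N. a i j * R' j k) = (\<Sum>j<N. (a i j + a i N * w j) * R j k)" for i k
    by (simp add: R'_def algebra_simps sum.distrib sum_distrib_left)
  then show ?case using R step.hyps by (intro exI[of _ R']) (auto simp: R'_def)
qed

section \<open>Substitution homomorphisms\<close>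

declare One_nat_def [simp del]

abbreviation coeff :: "mpoly \<Rightarrow> (nat \<Rightarrow>\<^sub>0 nat) \<Rightarrow> complex" where
  "coeff \<equiv> Poly_Mapping.lookup"

abbreviation monom_single :: "nat \<Rightarrow> nat \<Rightarrow> nat \<Rightarrow>\<^sub>0 nat" where
  "monom_single \<equiv> Poly_Mapping.single"

definition mvar :: "nat \<Rightarrow> mpoly" where
  "mvar i = Poly_Mapping.single (monom_single i 1) 1"

definition mon_eval :: "(nat \<Rightarrow> mpoly) \<Rightarrow> (nat \<Rightarrow>\<^sub>0 nat) \<Rightarrow> mpoly" where
  "mon_eval g m = (\<Prod>i\<in>Poly_Mapping.keys m. g i ^ Poly_Mapping.lookup m i)"

definition msubst :: "(nat \<Rightarrow> mpoly) \<Rightarrow> mpoly \<Rightarrow> mpoly" where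
  "msubst g P = (\<Sum>m\<in>Poly_Mapping.keys P. cpoly (coeff P m) * mon_eval g m)"

definition mdeg :: "(nat \<Rightarrow>\<^sub>0 nat) \<Rightarrow> nat" where
  "mdeg m = (\<Sum>i\<in>Poly_Mapping.keys m. Poly_Mapping.lookup m i)"

text \<open>The \<open>k\<close>-th power of the ideal of polynomials vanishing at the origin.\<close>
definition mpow :: "nat \<Rightarrow> mpoly set" where
  "mpow k = {P. \<forall>m\<in>Poly_Mapping.keys P. k \<le> mdeg m}"

section \<open>Monomials and their degrees\<close>

lemma keys_nat_add: "Poly_Mapping.keys (m + m' :: nat \<Rightarrow>\<^sub>0 nat) = Poly_Mapping.keys m \<union> Poly_Mapping.keys m'"
  by (auto simp: in_keys_iff lookup_add)

text \<open>A nonzero monomial is divisible by some variable, and the quotient has smaller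
  degree.\<close>

lemma monomial_induct [case_names zero add]:
  fixes m :: "nat \<Rightarrow>\<^sub>0 nat"
  assumes zero: "Q 0" and add: "\<And>m i. Q m \<Longrightarrow> Q (m + monom_single i 1)"
  shows "Q m"
proof (induction "mdeg m" arbitrary: m rule: less_induct)
  case less
  show ?case
  proof (cases "m = 0")
    case False
    then obtain i where i: "i \<in> Poly_Mapping.keys m" by (metis keys_eq_empty ex_in_conv)
    define m' where "m' = m - monom_single i 1"
    have m: "m = m' + monom_single i 1"
      using i by (intro poly_mapping_eqI)
        (auto simp: m'_def lookup_add lookup_minus lookup_single when_def in_keys_iff)
    have "mdeg m' < mdeg m"
    proof -
      have "mdeg m' = (\<Sum>j\<in>Poly_Mapping.keys m. Poly_Mapping.lookup m' j)"
        unfolding mdeg_def m keys_nat_add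
        by (intro sum.mono_neutral_left) (auto simp: in_keys_iff)
      also have "\<dots> < mdeg m"
        unfolding mdeg_def using i
        by (intro sum_strict_mono_ex1) (auto simp: m'_def lookup_minus lookup_single when_def in_keys_iff)
      finally show ?thesis .
    qed
    with less add m show ?thesis by metis
  qed (use zero in simp)
qed

lemma mdeg_0 [simp]: "mdeg 0 = 0"
  by (simp add: mdeg_def)

lemma mdeg_single [simp]: "mdeg (monom_single i k) = k"
  by (cases "k = 0") (auto simp: mdeg_def)

lemma mdeg_add: "mdeg (m + m') = mdeg m + mdeg m'"
proof -
  have *: "mdeg x = (\<Sum>j\<in>Poly_Mapping.keys (m + m'). Poly_Mapping.lookup x j)"
    if "x = m \<or> x = m'" for x
    unfolding mdeg_def keys_nat_add using that
    by (intro sum.mono_neutral_left) (auto simp: in_keys_iff)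
  have "mdeg (m + m') = (\<Sum>j\<in>Poly_Mapping.keys (m + m'). Poly_Mapping.lookup m j + Poly_Mapping.lookup m' j)"
    by (simp add: mdeg_def lookup_add)
  then show ?thesis using *[of m] *[of m'] by (simp add: sum.distrib)
qed

lemma mdeg_eq_0: "mdeg m = 0 \<longleftrightarrow> m = 0"
  by (induction m rule: monomial_induct) (auto simp: mdeg_add poly_mapping_eq_iff lookup_add fun_eq_iff lookup_single when_def)

lemma mdeg_eq_1: "mdeg m = 1 \<Longrightarrow> \<exists>i. m = monom_single i 1"
  by (induction m rule: monomial_induct) (auto simp: mdeg_add mdeg_eq_0)

section \<open>Substitution is a homomorphism of algebras\<close>

lemma mon_eval_0 [simp]: "mon_eval g 0 = 1"
  by (simp add: mon_eval_def)

lemma mon_eval_single [simp]: "mon_eval g (monom_single i k) = g i ^ k"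
  by (cases "k = 0") (auto simp: mon_eval_def)

lemma mon_eval_add: "mon_eval g (m + m') = mon_eval g m * mon_eval g m'"
proof -
  have *: "mon_eval g x = (\<Prod>j\<in>Poly_Mapping.keys (m + m'). g j ^ Poly_Mapping.lookup x j)"
    if "x = m \<or> x = m'" for x
    unfolding mon_eval_def keys_nat_add using that
    by (intro prod.mono_neutral_left) (auto simp: in_keys_iff)
  have "mon_eval g (m + m') = (\<Prod>j\<in>Poly_Mapping.keys (m + m'). g j ^ Poly_Mapping.lookup m j * g j ^ Poly_Mapping.lookup m' j)"
    by (simp add: mon_eval_def lookup_add power_add)
  then show ?thesis using *[of m] *[of m'] by (simp add: prod.distrib)
qed

lemma cpoly_0 [simp]: "cpoly 0 = 0" and cpoly_1 [simp]: "cpoly 1 = 1"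
  by (simp_all add: cpoly_def)

lemma cpoly_add: "cpoly (c + d) = cpoly c + cpoly d"
  by (simp add: cpoly_def single_add)

lemma cpoly_mult: "cpoly (c * d) = cpoly c * cpoly d"
  by (simp add: cpoly_def mult_single)

lemma cpoly_minus: "cpoly (- c) = - cpoly c"
  by (simp add: cpoly_def single_uminus)

lemma cpoly_times_single: "cpoly c * Poly_Mapping.single m d = Poly_Mapping.single m (c * d)"
  by (simp add: cpoly_def mult_single)

lemma poly_mapping_sum_singles:
  "P = (\<Sum>m\<in>Poly_Mapping.keys P. Poly_Mapping.single m (Poly_Mapping.lookup P m))"
proof (rule poly_mapping_eqI)
  fix k
  have "(\<Sum>m\<in>Poly_Mapping.keys P. if m = k then Poly_Mapping.lookup P m else 0) = Poly_Mapping.lookup P k"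
    by (auto simp: in_keys_iff)
  then show "Poly_Mapping.lookup P k = Poly_Mapping.lookup (\<Sum>m\<in>Poly_Mapping.keys P. Poly_Mapping.single m (Poly_Mapping.lookup P m)) k"
    by (simp add: lookup_sum lookup_single when_def)
qed

lemma mon_eval_mvar: "mon_eval mvar m = Poly_Mapping.single m 1"
proof (induction m rule: monomial_induct)
  case zero
  show ?case by simp
next
  case (add m i)
  have "mon_eval mvar (m + monom_single i 1) = mon_eval mvar m * mvar i"
    by (simp only: mon_eval_add mon_eval_single power_one_right)
  also have "\<dots> = Poly_Mapping.single (m + monom_single i 1) 1"
    by (simp add: add mvar_def mult_single)
  finally show ?case .
qed

lemma msubst_superset:
  assumes "finite S" "Poly_Mapping.keys P \<subseteq> S"
  shows "msubst g P = (\<Sum>m\<in>S. cpoly (coeff P m) * mon_eval g m)"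
  unfolding msubst_def using assms by (intro sum.mono_neutral_left) (auto simp: in_keys_iff)

lemma msubst_add: "msubst g (P + Q) = msubst g P + msubst g Q"
proof -
  let ?S = "Poly_Mapping.keys P \<union> Poly_Mapping.keys Q"
  have "Poly_Mapping.keys (P + Q) \<subseteq> ?S" by (rule Poly_Mapping.keys_add)
  then show ?thesis
    by (simp add: msubst_superset[of ?S] lookup_add cpoly_add algebra_simps sum.distrib)
qed

lemma msubst_single: "msubst g (Poly_Mapping.single m c) = cpoly c * mon_eval g m"
  by (simp add: msubst_superset[of "{m}"])

lemma msubst_0 [simp]: "msubst g 0 = 0"
  by (simp add: msubst_def)

lemma msubst_cpoly [simp]: "msubst g (cpoly c) = cpoly c"
  using msubst_single[of g 0 c] by (simp add: cpoly_def)

lemma msubst_1 [simp]: "msubst g 1 = 1"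
  using msubst_cpoly[of g 1] by simp

lemma msubst_mvar [simp]: "msubst g (mvar i) = g i"
  by (simp add: mvar_def msubst_single)

lemma msubst_sum: "msubst g (sum F A) = (\<Sum>a\<in>A. msubst g (F a))"
  by (induction A rule: infinite_finite_induct) (auto simp: msubst_add)

text \<open>Both factors are expanded into monomials, where the claim is
  \<open>mon_eval_add\<close>.\<close>

lemma msubst_mult: "msubst g (P * Q) = msubst g P * msubst g Q"
proof -
  have 1: "msubst g (Poly_Mapping.single m c * Q) = cpoly c * mon_eval g m * msubst g Q" for m c
  proof -
    have "msubst g (Poly_Mapping.single m c * Q)
        = msubst g (\<Sum>m'\<in>Poly_Mapping.keys Q. Poly_Mapping.single m c * Poly_Mapping.single m' (coeff Q m'))"
      by (subst poly_mapping_sum_singles[of Q]) (simp add: sum_distrib_left)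
    also have "\<dots> = (\<Sum>m'\<in>Poly_Mapping.keys Q. cpoly c * mon_eval g m * (cpoly (coeff Q m') * mon_eval g m'))"
      by (simp add: msubst_sum mult_single msubst_single cpoly_mult mon_eval_add mult_ac)
    finally show ?thesis by (simp add: msubst_def sum_distrib_left)
  qed
  have "msubst g (P * Q) = msubst g (\<Sum>m\<in>Poly_Mapping.keys P. Poly_Mapping.single m (coeff P m) * Q)"
    by (subst poly_mapping_sum_singles[of P]) (simp add: sum_distrib_right)
  then show ?thesis by (simp add: msubst_sum 1 msubst_def[of g P] sum_distrib_right)
qed

lemma msubst_diff: "msubst g (P - Q) = msubst g P - msubst g Q"
  using msubst_add[of g "P - Q" Q] by simp

section \<open>The subalgebra of polynomials in the first variables\<close>

lemma polys_cpoly [simp]: "cpoly c \<in> polys n"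
  by (auto simp: polys_def cpoly_def)

lemma polys_0 [simp]: "0 \<in> polys n" and polys_1 [simp]: "1 \<in> polys n"
  using polys_cpoly[of 0 n] polys_cpoly[of 1 n] by simp_all

lemma polys_mvar [simp]: "i < n \<Longrightarrow> mvar i \<in> polys n"
  by (auto simp: polys_def mvar_def)

lemma polys_add: "P \<in> polys n \<Longrightarrow> Q \<in> polys n \<Longrightarrow> P + Q \<in> polys n"
  using Poly_Mapping.keys_add[of P Q] unfolding polys_def by blast

lemma polys_mult: "P \<in> polys n \<Longrightarrow> Q \<in> polys n \<Longrightarrow> P * Q \<in> polys n"
  using keys_mult[of P Q] unfolding polys_def by (force simp: keys_nat_add)

lemma polys_diff: "P \<in> polys n \<Longrightarrow> Q \<in> polys n \<Longrightarrow> P - Q \<in> polys n"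
proof -
  assume "P \<in> polys n" "Q \<in> polys n"
  then have "P + cpoly (- 1) * Q \<in> polys n" by (intro polys_add polys_mult) auto
  then show ?thesis by (simp add: cpoly_minus)
qed

lemma polys_sum: "(\<And>a. a \<in> A \<Longrightarrow> F a \<in> polys n) \<Longrightarrow> sum F A \<in> polys n"
  by (induction A rule: infinite_finite_induct) (auto simp: polys_add)

lemma polys_mono: "n \<le> N \<Longrightarrow> polys n \<subseteq> polys N"
  by (fastforce simp: polys_def)

text \<open>The variables generate the algebra, so identities between homomorphisms need checking
  only on constants and variables. Membership is carried along because \<open>alg_endo\<close>
  constrains sums and products only within \<open>polys n\<close>.\<close>

lemma polys_induct [consumes 1, case_names const var add mult]:
  assumes P: "P \<in> polys n"
    and const: "\<And>c. Q (cpoly c)"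
    and var: "\<And>i. i < n \<Longrightarrow> Q (mvar i)"
    and add: "\<And>P R. P \<in> polys n \<Longrightarrow> R \<in> polys n \<Longrightarrow> Q P \<Longrightarrow> Q R \<Longrightarrow> Q (P + R)"
    and mult: "\<And>P R. P \<in> polys n \<Longrightarrow> R \<in> polys n \<Longrightarrow> Q P \<Longrightarrow> Q R \<Longrightarrow> Q (P * R)"
  shows "Q P"
proof -
  have Q1: "Q 1" and Q0: "Q 0" using const[of 1] const[of 0] by simp_all
  have mon: "Q (mon_eval mvar m) \<and> mon_eval mvar m \<in> polys n" if "Poly_Mapping.keys m \<subseteq> {..<n}" for m
    using that
  proof (induction m rule: monomial_induct)
    case (add m i)
    then have "i < n" "Poly_Mapping.keys m \<subseteq> {..<n}" by (auto simp: keys_nat_add)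
    with add.IH show ?case
      by (simp add: mon_eval_add mult var polys_mult)
  qed (use Q1 in simp)
  have "Q (\<Sum>m\<in>M. Poly_Mapping.single m (coeff P m)) \<and> (\<Sum>m\<in>M. Poly_Mapping.single m (coeff P m)) \<in> polys n"
    if "finite M" "\<And>m. m \<in> M \<Longrightarrow> Poly_Mapping.keys m \<subseteq> {..<n}" for M
    using that
  proof (induction M rule: finite_induct)
    case (insert m M)
    have "Poly_Mapping.single m (coeff P m) = cpoly (coeff P m) * mon_eval mvar m"
      by (simp add: mon_eval_mvar cpoly_times_single)
    with insert mon[of m] show ?case by (auto intro!: add mult const polys_add polys_mult)
  qed (use Q0 in simp)
  from this[of "Poly_Mapping.keys P"] P poly_mapping_sum_singles[of P] show ?thesis
    by (simp add: polys_def)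
qed

text \<open>Only finitely many variables occur in a polynomial; this makes
  \<open>polys_induct\<close> available when no bound is given.\<close>

lemma polys_exhaust: "\<exists>n. P \<in> polys n"
proof -
  have "finite (\<Union>m\<in>Poly_Mapping.keys P. Poly_Mapping.keys m)" by simp
  then obtain n where "\<forall>i\<in>(\<Union>m\<in>Poly_Mapping.keys P. Poly_Mapping.keys m). i < n"
    using finite_nat_set_iff_bounded by blast
  then show ?thesis by (auto simp: polys_def)
qed

lemma msubst_in_polys:
  assumes "P \<in> polys n" "\<And>i. i < n \<Longrightarrow> g i \<in> polys k"
  shows "msubst g P \<in> polys k"
  using assms(1)
  by (induction rule: polys_induct) (auto simp: msubst_add msubst_mult polys_add polys_mult assms(2))

lemma msubst_cong:
  assumes "P \<in> polys n" "\<And>i. i < n \<Longrightarrow> g i = h i"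
  shows "msubst g P = msubst h P"
  using assms(1)
  by (induction rule: polys_induct) (auto simp: msubst_add msubst_mult assms(2))

lemma msubst_id:
  assumes "P \<in> polys n" "\<And>i. i < n \<Longrightarrow> g i = mvar i"
  shows "msubst g P = P"
  using assms(1)
  by (induction rule: polys_induct) (auto simp: msubst_add msubst_mult assms(2))

lemma msubst_msubst: "msubst g (msubst h P) = msubst (\<lambda>i. msubst g (h i)) P"
proof -
  obtain n where "P \<in> polys n" using polys_exhaust by blast
  then show ?thesis by (induction rule: polys_induct) (auto simp: msubst_add msubst_mult)
qed

section \<open>Endomorphisms as substitutions, and inverses of automorphisms\<close>

lemma alg_endo_msubst:
  assumes "\<And>i. i < n \<Longrightarrow> g i \<in> polys n"
  shows "alg_endo n (msubst g)"
  using assms unfolding alg_endo_def by (auto simp: msubst_add msubst_mult intro: msubst_in_polys)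

text \<open>A homomorphism is determined by its values on generators. Through this, abstract
  endomorphisms become substitutions, whose linear parts can be computed.\<close>

lemma alg_endo_eq_msubst:
  assumes "alg_endo n f" "P \<in> polys n"
  shows "f P = msubst (\<lambda>i. f (mvar i)) P"
  using assms(2)
proof (induction rule: polys_induct)
  case (const c)
  have "f (cpoly c * 1) = cpoly c * f 1"
    using assms(1) polys_1 unfolding alg_endo_def by blast
  then show ?case using assms(1) by (simp add: alg_endo_def)
next
  case (add P Q)
  then show ?case using assms(1) by (simp add: alg_endo_def msubst_add)
next
  case (mult P Q)
  then show ?case using assms(1) by (simp add: alg_endo_def msubst_mult)
qed simp

lemma alg_auto_inv:
  assumes "alg_auto n f"
  shows "alg_auto n (inv_into (polys n) f)"
proof -
  let ?g = "inv_into (polys n) f"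
  have endo: "alg_endo n f" and bij: "bij_betw f (polys n) (polys n)"
    using assms by (auto simp: alg_auto_def)
  have g: "?g P \<in> polys n" "f (?g P) = P" if "P \<in> polys n" for P
    using bij that by (auto simp: bij_betw_def inv_into_into f_inv_into_f)
  \<comment> \<open>Injectivity of \<open>f\<close>: a value of the inverse is identified by
    applying \<open>f\<close> to the candidate.\<close>
  have eq: "?g Q = P" if "P \<in> polys n" "f P = Q" for P Q
    using bij that by (auto simp: bij_betw_def)
  have "alg_endo n ?g"
    unfolding alg_endo_def
  proof (intro conjI ballI allI)
    fix P Q assume PQ: "P \<in> polys n" "Q \<in> polys n"
    show "?g (P + Q) = ?g P + ?g Q" "?g (P * Q) = ?g P * ?g Q"
      using endo g[OF PQ(1)] g[OF PQ(2)]
      by (auto intro!: eq polys_add polys_mult simp: alg_endo_def)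
  next
    fix c P assume "P \<in> polys n"
    then show "?g (cpoly c * P) = cpoly c * ?g P"
      using endo g[of P] by (auto intro!: eq polys_mult simp: alg_endo_def)
  next
    show "?g 1 = 1" using endo by (auto intro!: eq simp: alg_endo_def)
  qed (use g in auto)
  then show ?thesis using bij by (simp add: alg_auto_def bij_betw_inv_into)
qed

section \<open>Order of vanishing and linear parts at the origin\<close>

abbreviation lin :: "mpoly \<Rightarrow> nat \<Rightarrow> complex" where
  "lin P i \<equiv> coeff P (monom_single i 1)"

lemma mpow_iff: "P \<in> mpow k \<longleftrightarrow> (\<forall>m. mdeg m < k \<longrightarrow> coeff P m = 0)"
  unfolding mpow_def by (auto simp: in_keys_iff not_le[symmetric])

lemma mpow_1: "P \<in> mpow 1 \<longleftrightarrow> coeff P 0 = 0"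
  by (auto simp: mpow_iff mdeg_eq_0)

lemma mpow_2: "P \<in> mpow 2 \<longleftrightarrow> coeff P 0 = 0 \<and> (\<forall>i. lin P i = 0)"
proof
  assume "P \<in> mpow 2"
  then show "coeff P 0 = 0 \<and> (\<forall>i. lin P i = 0)" by (simp add: mpow_iff)
next
  assume *: "coeff P 0 = 0 \<and> (\<forall>i. lin P i = 0)"
  have "coeff P m = 0" if "mdeg m < 2" for m
    using that * mdeg_eq_1[of m] mdeg_eq_0[of m] by (auto simp: less_2_cases_iff)
  then show "P \<in> mpow 2" by (simp add: mpow_iff)
qed

lemma mpow_0 [simp]: "P \<in> mpow 0"
  by (simp add: mpow_iff)

lemma mpow_zero [simp]: "0 \<in> mpow k"
  by (simp add: mpow_iff)

lemma mpow_antimono: "P \<in> mpow k \<Longrightarrow> l \<le> k \<Longrightarrow> P \<in> mpow l"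
  by (auto simp: mpow_iff)

lemma mpow_add: "P \<in> mpow k \<Longrightarrow> Q \<in> mpow k \<Longrightarrow> P + Q \<in> mpow k"
  by (auto simp: mpow_iff lookup_add)

lemma mpow_diff: "P \<in> mpow k \<Longrightarrow> Q \<in> mpow k \<Longrightarrow> P - Q \<in> mpow k"
  by (auto simp: mpow_iff lookup_minus)

lemma mpow_sum: "(\<And>a. a \<in> A \<Longrightarrow> F a \<in> mpow k) \<Longrightarrow> sum F A \<in> mpow k"
  by (induction A rule: infinite_finite_induct) (auto simp: mpow_add)

lemma mpow_mult: "P \<in> mpow k \<Longrightarrow> Q \<in> mpow l \<Longrightarrow> P * Q \<in> mpow (k + l)"
  using keys_mult[of P Q] unfolding mpow_def by (force simp: mdeg_add intro: add_mono)

lemma mpow_cpoly_mult: "P \<in> mpow k \<Longrightarrow> cpoly c * P \<in> mpow k"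
  using mpow_mult[of "cpoly c" 0 P k] by simp

lemma coeff_cpoly_mult [simp]: "coeff (cpoly c * P) m = c * coeff P m"
proof -
  have "cpoly c * P = (\<Sum>k\<in>Poly_Mapping.keys P. Poly_Mapping.single k (c * coeff P k))"
    by (subst (1) poly_mapping_sum_singles[of P]) (simp add: sum_distrib_left cpoly_times_single)
  then have "coeff (cpoly c * P) m = (\<Sum>k\<in>Poly_Mapping.keys P. if k = m then c * coeff P k else 0)"
    by (simp add: lookup_sum lookup_single when_def)
  then show ?thesis by (simp add: in_keys_iff)
qed

lemma coeff_0_mvar [simp]: "coeff (mvar i) 0 = 0"
proof -
  have "monom_single i 1 \<noteq> 0" by (metis mdeg_0 mdeg_single zero_neq_one)
  then show ?thesis by (simp add: mvar_def lookup_single when_def)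
qed

lemma lin_mvar: "lin (mvar i) j = (if i = j then 1 else 0)"
proof -
  have "monom_single i 1 = monom_single j 1 \<longleftrightarrow> i = j"
    by (metis keys_single one_neq_zero singleton_inject)
  then show ?thesis by (simp add: mvar_def lookup_single when_def)
qed

lemma coeff_cpoly_0 [simp]: "coeff (cpoly c) 0 = c"
  by (simp add: cpoly_def)

text \<open>Each of the \<open>mdeg m\<close> factors vanishes at the origin.\<close>

lemma mon_eval_in_mpow:
  assumes "\<And>i. i \<in> Poly_Mapping.keys m \<Longrightarrow> g i \<in> mpow 1"
  shows "mon_eval g m \<in> mpow (mdeg m)"
  using assms
proof (induction m rule: monomial_induct)
  case (add m i)
  then have "mon_eval g m * g i \<in> mpow (mdeg m + 1)"
    by (intro mpow_mult) (auto simp: keys_nat_add)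
  then show ?case by (simp add: mon_eval_add mdeg_add)
qed simp

lemma msubst_in_mpow:
  assumes "P \<in> mpow k" "\<And>i. g i \<in> mpow 1"
  shows "msubst g P \<in> mpow k"
  unfolding msubst_def
proof (rule mpow_sum)
  fix m assume "m \<in> Poly_Mapping.keys P"
  then have "k \<le> mdeg m" using assms(1) by (auto simp: mpow_def)
  with mon_eval_in_mpow[of m g] assms(2) show "cpoly (coeff P m) * mon_eval g m \<in> mpow k"
    by (blast intro: mpow_cpoly_mult mpow_antimono)
qed

text \<open>Evaluation at the origin is itself a substitution, so the composition law computes
  constant terms.\<close>

lemma msubst_zero_fun: "msubst (\<lambda>_. 0) P = cpoly (coeff P 0)"
proof -
  have "mon_eval (\<lambda>_. 0) m = (if m = 0 then 1 else 0)" for m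
  proof (cases "m = 0")
    case False
    then obtain i where "i \<in> Poly_Mapping.keys m" by (metis keys_eq_empty ex_in_conv)
    then have "(0 :: mpoly) ^ Poly_Mapping.lookup m i = 0" by (simp add: in_keys_iff)
    with \<open>i \<in> Poly_Mapping.keys m\<close> False show ?thesis
      unfolding mon_eval_def by (auto intro!: prod_zero)
  qed simp
  then have "msubst (\<lambda>_. 0) P = (\<Sum>m\<in>Poly_Mapping.keys P. if m = 0 then cpoly (coeff P 0) else 0)"
    unfolding msubst_def by (intro sum.cong) auto
  then show ?thesis by (auto simp: in_keys_iff)
qed

lemma mpow_2_remainder:
  assumes "P \<in> polys n" "P \<in> mpow 1"
  shows "P - (\<Sum>j<n. cpoly (lin P j) * mvar j) \<in> mpow 2"
proof -
  \<comment> \<open>Variables outside \<open>polys n\<close> do not occur, so the sum over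
    \<open>j < n\<close> is the whole linear part of \<open>P\<close>.\<close>
  have "lin P i = 0" if "\<not> i < n" for i
  proof (rule ccontr)
    assume "lin P i \<noteq> 0"
    then have "monom_single i 1 \<in> Poly_Mapping.keys P" unfolding in_keys_iff .
    then have "Poly_Mapping.keys (monom_single i 1) \<subseteq> {..<n}"
      using assms(1) unfolding polys_def by blast
    then show False using that by simp
  qed
  then have lin: "(\<Sum>j<n. lin P j * (if j = i then 1 else 0)) = lin P i" for i
    by (simp add: if_distrib[of "(*) _"] cong: if_cong)
  let ?L = "\<Sum>j<n. cpoly (lin P j) * mvar j"
  have "lin (P - ?L) i = lin P i - (\<Sum>j<n. lin P j * (if j = i then 1 else 0))" for i
    by (simp only: lookup_minus lookup_sum coeff_cpoly_mult lin_mvar)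
  then have "lin (P - ?L) i = 0" for i unfolding lin by simp
  moreover have "coeff (P - ?L) 0 = 0"
    using assms(2) by (simp add: mpow_1 lookup_minus lookup_sum)
  ultimately show ?thesis unfolding mpow_2 by blast
qed

text \<open>The chain rule at the origin: as \<open>g\<close> preserves the origin, the part of
  \<open>P\<close> of order at least two keeps that order, and only the linear part of
  \<open>P\<close> contributes.\<close>

lemma lin_msubst:
  assumes "P \<in> polys n" "P \<in> mpow 1" "\<And>i. g i \<in> mpow 1"
  shows "lin (msubst g P) k = (\<Sum>j<n. lin P j * lin (g j) k)"
proof -
  let ?L = "\<Sum>j<n. cpoly (lin P j) * mvar j"
  have "msubst g (P - ?L) \<in> mpow 2"
    using assms by (intro msubst_in_mpow mpow_2_remainder)
  then have "lin (msubst g P) k = lin (msubst g ?L) k"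
    by (simp add: mpow_2 msubst_diff lookup_minus)
  then show ?thesis by (simp add: msubst_sum msubst_mult lookup_sum)
qed

text \<open>A substitution that is the identity to first order preserves initial forms.\<close>
lemma msubst_near_identity_mpow:
  assumes P: "P \<in> polys n" "P \<in> mpow d" and g: "\<And>i. i < n \<Longrightarrow> g i - mvar i \<in> mpow 2"
  shows "msubst g P - P \<in> mpow (Suc d)"
proof -
  have g1: "g i \<in> mpow 1" if "i < n" for i
    using g[OF that] by (auto simp: mpow_1 mpow_2 lookup_minus)
  have mon: "mon_eval g m - mon_eval mvar m \<in> mpow (Suc (mdeg m))"
    if "Poly_Mapping.keys m \<subseteq> {..<n}" for m
    using that
  proof (induction m rule: monomial_induct)
    case (add m i)
    then have i: "i < n" and m: "Poly_Mapping.keys m \<subseteq> {..<n}" by (auto simp: keys_nat_add)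
    \<comment> \<open>Each summand has order one more than the degree of the product: the first
      through the factor \<open>g i - mvar i\<close>, the second by induction.\<close>
    have "mon_eval g (m + monom_single i 1) - mon_eval mvar (m + monom_single i 1)
        = mon_eval g m * (g i - mvar i) + (mon_eval g m - mon_eval mvar m) * mvar i"
      by (simp add: mon_eval_add algebra_simps)
    moreover have "mon_eval g m * (g i - mvar i) \<in> mpow (mdeg m + 2)"
      using m by (intro mpow_mult mon_eval_in_mpow g i) (auto intro: g1)
    moreover have "(mon_eval g m - mon_eval mvar m) * mvar i \<in> mpow (Suc (mdeg m) + 1)"
      by (intro mpow_mult add.IH m) (simp add: mpow_1)
    moreover have "Suc (mdeg (m + monom_single i 1)) = mdeg m + 2" "Suc (mdeg m) + 1 = mdeg m + 2"
      by (simp_all add: mdeg_add)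
    ultimately show ?case by (simp only: mpow_add)
  qed simp
  have "msubst g P - P = msubst g P - msubst mvar P"
    using P(1) by (simp add: msubst_id)
  also have "\<dots> = (\<Sum>m\<in>Poly_Mapping.keys P. cpoly (coeff P m) * (mon_eval g m - mon_eval mvar m))"
    by (simp add: msubst_def sum_subtractf algebra_simps)
  also have "\<dots> \<in> mpow (Suc d)"
  proof (intro mpow_sum mpow_cpoly_mult)
    fix m assume "m \<in> Poly_Mapping.keys P"
    with P have "Poly_Mapping.keys m \<subseteq> {..<n}" "d \<le> mdeg m" by (auto simp: polys_def mpow_def)
    with mon show "mon_eval g m - mon_eval mvar m \<in> mpow (Suc d)"
      using mpow_antimono by blast
  qed
  finally show ?thesis .
qed

lemma mpow_all_imp_0:
  assumes "\<And>d. P \<in> mpow d"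
  shows "P = 0"
proof (rule poly_mapping_eqI)
  fix m show "coeff P m = coeff 0 m"
    using assms[of "Suc (mdeg m)"] by (simp add: mpow_iff)
qed

text \<open>If \<open>P\<close> and \<open>Q\<close> have equal images, \<open>P - Q\<close> has
  image zero, so its order of vanishing at the origin can be raised by one again and again; hence
  \<open>P - Q\<close> is zero.\<close>

lemma msubst_near_identity_inj:
  assumes g: "\<And>i. i < n \<Longrightarrow> g i - mvar i \<in> mpow 2"
  shows "inj_on (msubst g) (polys n)"
proof (rule inj_onI)
  fix P Q assume PQ: "P \<in> polys n" "Q \<in> polys n" "msubst g P = msubst g Q"
  have "P - Q \<in> mpow d" for d
  proof (induction d)
    case (Suc d)
    have "msubst g (P - Q) - (P - Q) \<in> mpow (Suc d)"
      by (rule msubst_near_identity_mpow[OF _ Suc g]) (auto intro: polys_diff PQ)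
    then have "0 - (msubst g (P - Q) - (P - Q)) \<in> mpow (Suc d)" by (rule mpow_diff[OF mpow_zero])
    then show ?case using PQ(3) by (simp add: msubst_diff)
  qed simp
  then show "P = Q" using mpow_all_imp_0[of "P - Q"] by simp
qed

section \<open>Injective retractions\<close>

text \<open>The case of a substitution preserving the origin, decided by linear parts: the Jacobian
  of the composite on the first \<open>n\<close> variables is made invertible, then normalized to
  the identity.\<close>

lemma ex_retraction_inj_origin:
  assumes F: "\<And>i. i < N \<Longrightarrow> F i \<in> polys N" "\<And>i. F i \<in> mpow 1" and G: "\<And>i. G i \<in> mpow 1"
    and GF: "\<And>i. i < N \<Longrightarrow> msubst G (F i) = mvar i" and nN: "n \<le> N"
  shows "\<exists>r. (\<forall>i<n. r i = mvar i) \<and> (\<forall>i. r i \<in> polys n) \<and> inj_on (\<lambda>P. msubst r (msubst F P)) (polys n)"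
proof -
  \<comment> \<open>The Jacobian matrix of \<open>F\<close> at the origin.\<close>
  define a where "a i j = lin (F i) j" for i j
  have "indep_rows n N a"
    unfolding indep_rows_def
  proof (intro allI impI)
    fix u k assume u: "\<forall>j<N. (\<Sum>i<n. u i * a i j) = 0" and k: "k < n"
    \<comment> \<open>By the chain rule the Jacobian of \<open>G\<close> is a right inverse of
      \<open>a\<close>; multiplying \<open>u a = 0\<close> by it gives \<open>u = 0\<close>.\<close>
    have aG: "(\<Sum>j<N. a i j * lin (G j) k) = (if i = k then 1 else 0)" if "i < n" for i
      using lin_msubst[of "F i" N G k] F G GF[of i] that nN by (simp add: a_def lin_mvar)
    have "u k = (\<Sum>i<n. u i * (if i = k then 1 else 0))"
      using k by (simp add: if_distrib[of "(*) _"] cong: if_cong)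
    also have "\<dots> = (\<Sum>i<n. u i * (\<Sum>j<N. a i j * lin (G j) k))"
      using aG by simp
    also have "\<dots> = (\<Sum>j<N. (\<Sum>i<n. u i * a i j) * lin (G j) k)"
      unfolding sum_distrib_left sum_distrib_right by (subst sum.swap) (simp add: mult.assoc)
    finally show "u k = 0" using u by simp
  qed
  from indep_rows_retract[OF nN this] obtain R where
    R: "\<And>j k. j < n \<Longrightarrow> R j k = (if j = k then 1 else 0)"
    and ind: "indep_rows n n (\<lambda>i k. \<Sum>j<N. a i j * R j k)" by blast
  from indep_rows_right_inverse[OF ind] obtain b where
    b: "\<And>i l. i < n \<Longrightarrow> l < n \<Longrightarrow> (\<Sum>k<n. (\<Sum>j<N. a i j * R j k) * b k l) = (if i = l then 1 else 0)"
    by blast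
  define linform :: "(nat \<Rightarrow> complex) \<Rightarrow> mpoly" where
    "linform v = (\<Sum>k<n. cpoly (v k) * mvar k)" for v
  have linform: "linform v \<in> polys n" "linform v \<in> mpow 1" for v
    by (auto simp: linform_def mpow_1 lookup_sum intro!: polys_sum polys_mult)
  have lin_linform: "lin (linform v) l = (if l < n then v l else 0)" for v l
    by (simp add: linform_def lookup_sum lin_mvar if_distrib[of "(*) _"] cong: if_cong)
  \<comment> \<open>\<open>r\<close> is the linear retraction with matrix \<open>R\<close>;
    \<open>s\<close> is the linear change of variables that inverts the Jacobian left after applying
    \<open>r\<close>.\<close>
  define r where "r j = linform (R j)" for j
  define s where "s k = linform (b k)" for k
  have r_id: "r i = mvar i" if "i < n" for i
  proof -
    have "r i = (\<Sum>k<n. if k = i then mvar k else 0)"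
      unfolding r_def linform_def using R[OF that] by (intro sum.cong) auto
    then show ?thesis using that by simp
  qed
  have r: "r i \<in> polys n" "r i \<in> mpow 1" and s: "s i \<in> polys n" "s i \<in> mpow 1" for i
    by (auto simp: r_def s_def linform)
  define g where "g i = msubst s (msubst r (F i))" for i
  have "g i - mvar i \<in> mpow 2" if i: "i < n" for i
  proof -
    have Fi: "F i \<in> polys N" "F i \<in> mpow 1" using F i nN by auto
    have rF: "msubst r (F i) \<in> polys n" "msubst r (F i) \<in> mpow 1"
      using r Fi by (auto intro: msubst_in_polys msubst_in_mpow)
    have "g i \<in> mpow 1" unfolding g_def by (rule msubst_in_mpow[OF rF(2) s(2)])
    moreover have "lin (g i) l = (if i = l then 1 else 0)" for l
    proof -
      \<comment> \<open>The chain rule, used twice, gives the matrix product of \<open>a\<close>,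
        \<open>R\<close> and \<open>b\<close>.\<close>
      have "lin (g i) l = (\<Sum>k<n. (\<Sum>j<N. a i j * (if k < n then R j k else 0)) * (if l < n then b k l else 0))"
        unfolding g_def using rF Fi r s
        by (simp add: lin_msubst[of _ n] lin_msubst[of _ N] a_def r_def s_def lin_linform)
      also have "\<dots> = (if i = l then 1 else 0)"
        using b[OF i, of l] i by (cases "l < n") auto
      finally show ?thesis .
    qed
    ultimately show ?thesis by (simp add: mpow_1 mpow_2 lookup_minus lin_mvar)
  qed
  then have "inj_on (msubst g) (polys n)" by (rule msubst_near_identity_inj)
  moreover have "msubst g = msubst s \<circ> (\<lambda>P. msubst r (msubst F P))"
    by (simp add: fun_eq_iff msubst_msubst g_def[abs_def])
  ultimately have "inj_on (\<lambda>P. msubst r (msubst F P)) (polys n)"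
    by (metis inj_on_imageI2)
  then show ?thesis using r_id r by blast
qed

text \<open>Reduction to the origin-preserving case by a translation. It changes each variable by a
  constant, so it maps \<open>polys n\<close> to itself and injectivity there can be
  transferred.\<close>

lemma ex_retraction_inj:
  assumes f: "\<And>i. i < N \<Longrightarrow> f i \<in> polys N"
    and fg: "\<And>i. msubst f (g i) = mvar i" and gf: "\<And>i. msubst g (f i) = mvar i" and nN: "n \<le> N"
  shows "\<exists>r. (\<forall>i<n. r i = mvar i) \<and> (\<forall>i. r i \<in> polys n) \<and> inj_on (\<lambda>P. msubst r (msubst f P)) (polys n)"
proof -
  define c where "c i = coeff (f i) 0" for i
  define T where "T i = mvar i - cpoly (c i)" for i
  define T' where "T' i = mvar i + cpoly (c i)" for i
  \<comment> \<open>As maps on polynomials, \<open>F\<close> is \<open>T\<close> followed by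
    \<open>f\<close>, and \<open>G\<close> is \<open>g\<close> followed by the inverse translation
    \<open>T'\<close>.\<close>
  define F where "F i = msubst f (T i)" for i
  define G where "G i = msubst T' (g i)" for i
  have F: "F i = f i - cpoly (c i)" for i by (simp add: F_def T_def msubst_diff)
  have TT': "msubst T (T' i) = mvar i" "msubst T' (T i) = mvar i" for i
    by (simp_all add: T_def T'_def msubst_diff msubst_add)
  have "F i \<in> polys N" if "i < N" for i using f[OF that] by (simp add: F polys_diff)
  moreover have "F i \<in> mpow 1" for i by (simp add: F mpow_1 lookup_minus c_def)
  moreover have "G i \<in> mpow 1" for i
  proof -
    \<comment> \<open>At the origin \<open>T'\<close> and \<open>f\<close> both take the values
      \<open>c\<close>, so the constant term of \<open>G i\<close> is that of
      \<open>msubst f (g i) = mvar i\<close>.\<close>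
    have "cpoly (coeff (G i) 0) = msubst (\<lambda>_. 0) (msubst f (g i))"
      unfolding G_def msubst_zero_fun[symmetric] msubst_msubst
      by (simp add: T'_def msubst_zero_fun c_def lookup_add)
    then have "coeff (cpoly (coeff (G i) 0)) 0 = 0" by (simp add: fg)
    then show ?thesis by (simp add: mpow_1)
  qed
  moreover have "msubst G (F i) = mvar i" for i
  proof -
    have "msubst G (F i) = msubst T' (msubst g (f i) - cpoly (c i))"
      unfolding F G_def by (simp add: msubst_msubst[symmetric] msubst_diff)
    also have "\<dots> = msubst T' (T i)" by (simp add: gf T_def)
    finally show ?thesis by (simp add: TT')
  qed
  ultimately obtain r where r: "\<forall>i<n. r i = mvar i" "\<forall>i. r i \<in> polys n"
    and inj: "inj_on (\<lambda>P. msubst r (msubst F P)) (polys n)"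
    using ex_retraction_inj_origin[of N F G n] nN by blast
  have "inj_on (\<lambda>P. msubst r (msubst f P)) (polys n)"
  proof (rule inj_onI)
    fix P Q assume PQ: "P \<in> polys n" "Q \<in> polys n" "msubst r (msubst f P) = msubst r (msubst f Q)"
    have inv: "msubst T (msubst T' P) = P" for P
      using polys_exhaust[of P] by (auto simp: msubst_msubst TT' msubst_id)
    \<comment> \<open>Undoing the translation expresses \<open>f\<close> as \<open>T'\<close>
      followed by \<open>F\<close>, and \<open>T'\<close> is injective.\<close>
    have FT: "msubst F (msubst T' P) = msubst f P" for P
      unfolding F_def msubst_msubst[symmetric] inv ..
    have "msubst T' P \<in> polys n" "msubst T' Q \<in> polys n"
      using PQ by (auto simp: T'_def polys_add intro: msubst_in_polys)
    with inj PQ(3) have "msubst T' P = msubst T' Q" by (auto simp: inj_on_def FT)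
    then show "P = Q" using inv by metis
  qed
  with r show ?thesis by blast
qed

text \<open>\<open>\<beta>\<close> is \<open>\<phi>\<close> followed by a retraction onto
  \<open>polys n\<close>. The retraction fixes \<open>polys n\<close>, hence the agreement wherever
  \<open>\<phi> P\<close> already lies there.\<close>

lemma alg_auto_induces_inj_endo:
  assumes phi: "alg_auto N \<phi>" and nN: "n \<le> N"
  shows "\<exists>\<beta>. alg_endo n \<beta> \<and> inj_on \<beta> (polys n) \<and> (\<forall>P\<in>polys n. \<phi> P \<in> polys n \<longrightarrow> \<beta> P = \<phi> P)"
proof -
  let ?\<psi> = "inv_into (polys N) \<phi>"
  have psi: "alg_auto N ?\<psi>" using phi by (rule alg_auto_inv)
  have endo: "alg_endo N \<phi>" "alg_endo N ?\<psi>" and bij: "bij_betw \<phi> (polys N) (polys N)"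
    using phi psi by (auto simp: alg_auto_def)
  \<comment> \<open>Variables of index at least \<open>N\<close> are fixed, so that inverse maps
    give substitutions that are mutually inverse on all variables, as
    \<open>ex_retraction_inj\<close> asks.\<close>
  define ext :: "(mpoly \<Rightarrow> mpoly) \<Rightarrow> nat \<Rightarrow> mpoly" where
    "ext h i = (if i < N then h (mvar i) else mvar i)" for h i
  have ext: "msubst (ext h) P = h P" if "alg_endo N h" "P \<in> polys N" for h P
    unfolding alg_endo_eq_msubst[OF that]
    by (rule msubst_cong[OF that(2)]) (simp add: ext_def)
  have polys: "ext h i \<in> polys N" if "alg_endo N h" "i < N" for h i
    using that by (simp add: ext_def alg_endo_def)
  have inv: "msubst (ext h) (ext k i) = mvar i"
    if "alg_endo N h" "alg_endo N k" "\<And>P. P \<in> polys N \<Longrightarrow> h (k P) = P" for h k i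
  proof (cases "i < N")
    case True
    then show ?thesis using ext[OF that(1) polys[OF that(2) True]] that(3) by (simp add: ext_def)
  qed (simp add: ext_def)
  have "\<phi> (?\<psi> P) = P" "?\<psi> (\<phi> P) = P" if "P \<in> polys N" for P
    using bij that by (auto simp: bij_betw_def f_inv_into_f)
  then obtain r where r: "\<forall>i<n. r i = mvar i" "\<forall>i. r i \<in> polys n"
    and inj: "inj_on (\<lambda>P. msubst r (msubst (ext \<phi>) P)) (polys n)"
    using ex_retraction_inj[of N "ext \<phi>" "ext ?\<psi>" n] inv endo polys nN by metis
  define \<beta> where "\<beta> = msubst (\<lambda>i. msubst r (ext \<phi> i))"
  have beta: "\<beta> P = msubst r (msubst (ext \<phi>) P)" for P
    by (simp add: \<beta>_def msubst_msubst)
  have "alg_endo n \<beta>"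
    unfolding \<beta>_def
  proof (rule alg_endo_msubst)
    fix i assume "i < n"
    then show "msubst r (ext \<phi> i) \<in> polys n"
      using msubst_in_polys[OF polys[OF endo(1)]] r(2) nN by auto
  qed
  moreover have "inj_on \<beta> (polys n)"
    using inj by (simp add: beta[abs_def] fun_eq_iff inj_on_def)
  moreover have "\<beta> P = \<phi> P" if "P \<in> polys n" "\<phi> P \<in> polys n" for P
    using that ext[OF endo(1), of P] polys_mono[OF nN] msubst_id[OF that(2), of r] r(1)
    by (auto simp: beta)
  ultimately show ?thesis by blast
qed

theorem theorem1p5:
  fixes n N :: nat and p q :: mpoly and \<phi> :: "mpoly \<Rightarrow> mpoly"
  assumes p: "p \<in> polys n"
    and rigid: "\<forall>\<psi>. alg_endo n \<psi> \<and> inj_on \<psi> (polys n) \<and> \<psi> p = p \<longrightarrow> alg_auto n \<psi>"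
    and q: "q \<in> polys n"
    and nN: "N \<ge> n"
    and phi: "alg_auto N \<phi>"
    and phipq: "\<phi> p = q"
  shows "\<exists>\<alpha>. alg_auto n \<alpha> \<and> \<alpha> p = q"
proof -
  let ?\<psi> = "inv_into (polys N) \<phi>"
  have psiq: "?\<psi> q = p"
    using phi p phipq polys_mono[OF nN] by (auto simp: alg_auto_def bij_betw_def)
  \<comment> \<open>Since \<open>q\<close> lies in \<open>polys n\<close>, \<open>\<beta>\<close>
    agrees with \<open>\<phi>\<close> at \<open>p\<close>; for the inverse the roles of
    \<open>p\<close> and \<open>q\<close> are exchanged.\<close>
  obtain \<beta> where \<beta>: "alg_endo n \<beta>" "inj_on \<beta> (polys n)" "\<beta> p = q"
    using alg_auto_induces_inj_endo[OF phi nN] p q phipq by auto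
  obtain \<gamma> where \<gamma>: "alg_endo n \<gamma>" "inj_on \<gamma> (polys n)" "\<gamma> q = p"
    using alg_auto_induces_inj_endo[OF alg_auto_inv[OF phi] nN] p q psiq by auto
  have maps: "\<beta> ` polys n \<subseteq> polys n" "\<gamma> ` polys n \<subseteq> polys n"
    using \<beta>(1) \<gamma>(1) by (auto simp: alg_endo_def)
  have "alg_endo n (\<gamma> \<circ> \<beta>)"
    using \<beta>(1) \<gamma>(1) unfolding alg_endo_def comp_def by metis
  moreover have "inj_on (\<gamma> \<circ> \<beta>) (polys n)"
    using \<beta>(2) \<gamma>(2) maps(1) by (blast intro: comp_inj_on inj_on_subset)
  ultimately have "alg_auto n (\<gamma> \<circ> \<beta>)"
    using rigid \<beta>(3) \<gamma>(3) by simp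
  then have surj: "\<gamma> ` \<beta> ` polys n = polys n"
    by (simp add: alg_auto_def bij_betw_def image_comp)
  \<comment> \<open>Surjectivity of \<open>\<beta>\<close>: \<open>\<gamma> P\<close> is a value of
    the surjective composite, and injectivity of \<open>\<gamma>\<close> cancels the outer
    map.\<close>
  have "polys n \<subseteq> \<beta> ` polys n"
  proof
    fix P assume P: "P \<in> polys n"
    then have "\<gamma> P \<in> \<gamma> ` \<beta> ` polys n" using maps(2) surj by auto
    then show "P \<in> \<beta> ` polys n"
      using inj_on_image_mem_iff[OF \<gamma>(2) P maps(1)] by blast
  qed
  then have "alg_auto n \<beta>"
    using \<beta> maps(1) by (auto simp: alg_auto_def bij_betw_def)
  with \<beta>(3) show ?thesis by blast
qed

end
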